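(* For any $\epsilon$ with $\frac{1}{2W}\le\epsilon\le\frac14$, the ratio between the memory consumption $\frac{1}{2\epsilon}+2\log W+O(1)$ (in bits) of Algorithm 1 for Basic-Counting and the lower bound $\max\left\{\log W,\frac{1}{2\epsilon+W^{-1}}\right\}$ for $W\epsilon$-additive approximations for Basic-Counting satisfies $$\frac{\frac{1}{2\epsilon}+2\log W+O(1)}{\max\left\{\log W,\ \frac{1}{2\epsilon+W^{-1}}\right\}}\le 3+o(1).$$
   Context: All logarithms are base 2; $W$ is a positive integer (the window size); $O(1)$ denotes a quantity bounded by an absolute constant; $o(1)$ is for $W\to\infty$, uniformly over the allowed $\epsilon$. Basic-Counting: given a stream of bits arriving one at a time, maintain $C^W$, the number of 1's among the last $W$ bits; a $W\epsilon$-additive approximation is an estimate within $W\epsilon$ of $C^W$ at all times. Algorithm 1 (with $k=\frac1{2\epsilon}$ and $\frac Wk$ assumed integers). Variables: integers $y,m,i,B$ and a bit array $b=(b_0,\dots,b_{k-1})$, all initialized to $0$. Add(bit $x$): if $m=\frac Wk-1$, then do in order $B\leftarrow B-b_i$; if $y+x\ge\frac Wk$ set $b_i\leftarrow1$, $y\leftarrow y-\frac Wk+x$, otherwise set $b_i\leftarrow0$, $y\leftarrow y+x$; $B\leftarrow B+b_i$; $m\leftarrow0$; $i\leftarrow i+1\bmod k$. If $m\ne\frac Wk-1$: $y\leftarrow y+x$, $m\leftarrow m+1$. Query: return $\frac Wk B+y-\frac W{2k}-m\,b_i$. Its memory consumption is $\frac{1}{2\epsilon}+2\log W+O(1)$ bits.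 *)

theory Defs
  imports Complex_Main
begin

text \<open>
  The counter is run with window size \<open>W\<close> and \<open>k\<close> blocks, where \<open>k = 1 / (2 * \<epsilon>)\<close> and \<open>k\<close> divides
  \<open>W\<close>; in that case \<^term>\<open>W div k\<close> is the exact quotient.
\<close>

record counter_state =
  reg_y :: int
  reg_m :: nat
  reg_i :: nat
  reg_B :: int
  arr_b :: "bool list"

definition initial_state :: "nat \<Rightarrow> counter_state" where
  "initial_state k =
     \<lparr>reg_y = 0, reg_m = 0, reg_i = 0, reg_B = 0, arr_b = replicate k False\<rparr>"

text \<open>The two branches are alternatives: exactly one of them is executed for each arriving bit.\<close>

definition add_bit :: "nat \<Rightarrow> nat \<Rightarrow> counter_state \<Rightarrow> bool \<Rightarrow> counter_state" where
  "add_bit W k s x =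
     (let y = reg_y s; m = reg_m s; i = reg_i s; B = reg_B s; b = arr_b s; w = int (W div k) in
      if m = W div k - 1 then
        let B1 = B - of_bool (b ! i);
            full = (y + of_bool x \<ge> w);
            b' = b[i := full];
            y' = (if full then y - w + of_bool x else y + of_bool x)
        in \<lparr>reg_y = y', reg_m = 0, reg_i = (i + 1) mod k,
            reg_B = B1 + of_bool (b' ! i), arr_b = b'\<rparr>
      else
        s\<lparr>reg_y := y + of_bool x, reg_m := m + 1\<rparr>)"

definition query :: "nat \<Rightarrow> nat \<Rightarrow> counter_state \<Rightarrow> real" where
  "query W k s =
     real W / real k * of_int (reg_B s) + of_int (reg_y s) - real W / (2 * real k)
       - real (reg_m s) * of_bool (arr_b s ! reg_i s)"

definition reachable_states :: "nat \<Rightarrow> nat \<Rightarrow> counter_state set" where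
  "reachable_states W k = range (\<lambda>xs. foldl (add_bit W k) (initial_state k) xs)"

text \<open>
  Every scalar variable is kept in its own field of fixed width, just wide enough to tell apart the
  values that the variable takes over all input streams; the bit array takes one bit per entry.
  In particular \<open>B\<close> is charged for, although it is determined by the array.
\<close>

definition field_bits :: "'a set \<Rightarrow> nat" where
  "field_bits V = nat \<lceil>log 2 (real (card V))\<rceil>"

definition memory_bits :: "nat \<Rightarrow> nat \<Rightarrow> nat" where
  "memory_bits W k =
     (let R = reachable_states W k in
      field_bits (reg_y ` R) + field_bits (reg_m ` R) + field_bits (reg_i ` R)
        + field_bits (reg_B ` R) + k)"

definition counting_lower_bound :: "nat \<Rightarrow> real \<Rightarrow> real" where
  "counting_lower_bound W \<epsilon> = max (log 2 (real W)) (1 / (2 * \<epsilon> + 1 / real W))"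

definition admissible :: "nat \<Rightarrow> real \<Rightarrow> bool" where
  "admissible W \<epsilon> \<longleftrightarrow> W > 0 \<and> 1 / (2 * real W) \<le> \<epsilon> \<and> \<epsilon> \<le> 1 / 4"

definition block_count :: "nat \<Rightarrow> real \<Rightarrow> nat \<Rightarrow> bool" where
  "block_count W \<epsilon> k \<longleftrightarrow> real k = 1 / (2 * \<epsilon>) \<and> k dvd W"

end

theory Submission
  imports Defs "HOL-Real_Asymp.Real_Asymp"
begin

text \<open>
  Write \<open>n = W div k\<close>. At a block boundary \<open>y < n\<close>, so \<open>y\<close> stays below \<open>n + m \<le> 2 * n - 1\<close>, while a
  stream consisting of ones only already drives \<open>y\<close>, \<open>m\<close> through \<open>0, \<dots>, n - 1\<close>, \<open>i\<close> through
  \<open>0, \<dots>, k - 1\<close> and \<open>B\<close> through \<open>0, \<dots>, k\<close>. Hence the four fields take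
  \<open>2 * log n + 2 * log k = 2 * log W\<close> bits up to a constant.

  For the ratio put \<open>x = 1 / (2 * \<epsilon>) \<le> W\<close>. Since the lower bound is at least \<open>x * W / (x + W)\<close> and at
  least \<open>log W\<close>, the term \<open>x\<close> contributes at most \<open>1 + x / W\<close> and \<open>2 * log W\<close> contributes at most \<open>2\<close>. If
  \<open>x \<le> sqrt W\<close> this is \<open>3 + o(1)\<close>; otherwise the lower bound is at least \<open>sqrt W / 2\<close>, the logarithmic
  term vanishes asymptotically and the ratio is \<open>2 + o(1)\<close>.
\<close>

text \<open>The bound on \<open>y\<close> moves with \<open>m\<close> to be inductive: at
  \<open>m = n - 1\<close> it gives \<open>y + x <= 2 * n - 1\<close>, so a single subtraction of
  \<open>n\<close> brings \<open>y\<close> below \<open>n\<close> again. The last conjunct confines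
  \<open>B\<close> to \<open>0, ..., k\<close>.\<close>

definition counter_invariant :: "nat \<Rightarrow> nat \<Rightarrow> counter_state \<Rightarrow> bool" where
  "counter_invariant n k s \<longleftrightarrow>
     0 \<le> reg_y s \<and> reg_y s < int n + int (reg_m s) \<and> reg_m s < n \<and> reg_i s < k \<and>
     length (arr_b s) = k \<and> reg_B s = (\<Sum>j<k. of_bool (arr_b s ! j))"

lemma sum_of_bool_list_update:
  assumes "i < k" "length b = k"
  shows "(\<Sum>j<k. of_bool (b[i := v] ! j) :: int) = (\<Sum>j<k. of_bool (b ! j)) - of_bool (b ! i) + of_bool v"
proof -
  have "(\<Sum>j\<in>{..<k} - {i}. of_bool (b[i := v] ! j) :: int) = (\<Sum>j\<in>{..<k} - {i}. of_bool (b ! j))"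
    by (rule sum.cong) (use assms in auto)
  then show ?thesis
    using assms sum.remove[of "{..<k}" i "\<lambda>j. of_bool (b[i := v] ! j) :: int"]
      sum.remove[of "{..<k}" i "\<lambda>j. of_bool (b ! j) :: int"]
    by simp
qed

lemma counter_invariant_add_bit:
  assumes "counter_invariant (W div k) k s"
  shows "counter_invariant (W div k) k (add_bit W k s x)"
proof (cases "reg_m s = W div k - 1")
  case True
  then show ?thesis
    using assms unfolding counter_invariant_def add_bit_def Let_def
    \<comment> \<open>\<open>sum_of_bool_eq\<close> would turn the sums into cardinalities, which
      \<open>sum_of_bool_list_update\<close> does not match.\<close>
    by (auto simp: sum_of_bool_list_update simp del: sum_of_bool_eq)
next
  case False
  then show ?thesis
    using assms unfolding counter_invariant_def add_bit_def Let_def by (cases x) auto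
qed

lemma counter_invariant_reachable:
  assumes "0 < k" "0 < W div k" "s \<in> reachable_states W k"
  shows "counter_invariant (W div k) k s"
proof -
  have "counter_invariant (W div k) k (foldl (add_bit W k) (initial_state k) xs)" for xs
  proof (induction xs rule: rev_induct)
    case Nil
    then show ?case
      using assms by (simp add: counter_invariant_def initial_state_def)
  qed (simp add: counter_invariant_add_bit)
  then show ?thesis
    using assms by (auto simp: reachable_states_def)
qed

text \<open>When all bits are 1, \<open>y\<close> and \<open>m\<close> agree, so every block ends
  with \<open>y + x\<close> exactly equal to the block length: \<open>y\<close> returns to 0 and a
  fresh array bit is set. At \<open>t = k * (W div k)\<close> the array is full and the index wraps
  to 0; after that \<open>B\<close> would stay at \<open>k\<close>.\<close>

lemma run_ones:
  assumes "0 < W div k" "t \<le> k * (W div k)"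
  shows "foldl (add_bit W k) (initial_state k) (replicate t True) =
    \<lparr>reg_y = int (t mod (W div k)), reg_m = t mod (W div k), reg_i = (t div (W div k)) mod k,
     reg_B = int (t div (W div k)),
     arr_b = replicate (t div (W div k)) True @ replicate (k - t div (W div k)) False\<rparr>"
  using assms(2)
proof (induction t)
  case 0
  then show ?case by (simp add: initial_state_def)
next
  case (Suc t)
  define n where "n = W div k"
  have n: "0 < n" using assms by (simp add: n_def)
  have lt: "t div n < k"
    using Suc.prems by (simp add: n_def less_mult_imp_div_less)
  \<comment> \<open>Before this step the index has not wrapped, so \<open>mod k\<close>
    disappears.\<close>
  have IH: "foldl (add_bit W k) (initial_state k) (replicate t True) =
    \<lparr>reg_y = int (t mod n), reg_m = t mod n, reg_i = t div n, reg_B = int (t div n),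
     arr_b = replicate (t div n) True @ replicate (k - t div n) False\<rparr>" (is "_ = ?s")
    using Suc lt by (simp add: n_def)
  have "foldl (add_bit W k) (initial_state k) (replicate (Suc t) True) = add_bit W k ?s True"
    by (simp flip: replicate_append_same add: IH)
  also have "\<dots> = \<lparr>reg_y = int (Suc t mod n), reg_m = Suc t mod n, reg_i = (Suc t div n) mod k,
     reg_B = int (Suc t div n),
     arr_b = replicate (Suc t div n) True @ replicate (k - Suc t div n) False\<rparr>"
  proof (cases "t mod n = n - 1")
    case True
    then have "Suc t mod n = 0" "Suc t div n = Suc (t div n)"
      using n by (simp_all add: mod_Suc div_Suc)
    \<comment> \<open>This splits off the first \<open>False\<close> of the array, the entry about
      to be overwritten.\<close>
    moreover have "k - t div n = Suc (k - Suc (t div n))"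
      using lt by simp
    ultimately show ?thesis
      using True n lt unfolding add_bit_def Let_def n_def[symmetric]
      by (simp add: list_update_append nth_append of_nat_diff replicate_append_same flip: append_Cons)
  next
    case False
    then have "Suc t mod n = Suc (t mod n)" "Suc t div n = t div n"
      using n by (simp_all add: mod_Suc div_Suc)
    then show ?thesis
      using False lt unfolding add_bit_def Let_def n_def[symmetric] by simp
  qed
  finally show ?case by (simp add: n_def)
qed

lemma run_ones_reachable:
  "foldl (add_bit W k) (initial_state k) (replicate t True) \<in> reachable_states W k"
  by (auto simp: reachable_states_def)

text \<open>One extra bit pays for the factor 2 in the cardinality, the other for the
  ceiling.\<close>

lemma field_bits_bounds:
  assumes "0 < p" "p \<le> card V" "card V \<le> 2 * p"
  shows "log 2 (real p) \<le> real (field_bits V)" "real (field_bits V) \<le> log 2 (real p) + 2"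
proof -
  have le: "log 2 (real p) \<le> log 2 (real (card V))"
    using assms by simp
  have "log 2 (real (card V)) \<le> log 2 (2 * real p)"
    using assms by (subst log_le_cancel_iff) auto
  also have "\<dots> = 1 + log 2 (real p)"
    using assms by (simp add: log_mult)
  finally have ge: "log 2 (real (card V)) \<le> 1 + log 2 (real p)" .
  \<comment> \<open>As \<open>V\<close> has at least one element, \<open>nat\<close> truncates
    nothing.\<close>
  have "0 \<le> log 2 (real (card V))"
    using assms by simp
  then have "real (field_bits V) = of_int \<lceil>log 2 (real (card V))\<rceil>"
    unfolding field_bits_def by simp
  then show "log 2 (real p) \<le> real (field_bits V)" "real (field_bits V) \<le> log 2 (real p) + 2"
    using le ge by linarith+
qed

text \<open>The exact value set \<open>V\<close> of a variable need not be computed: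
  \<open>U\<close> will come from the invariant and \<open>L\<close> from the stream of
  ones.\<close>

lemma field_bits_between:
  assumes "0 < p" "finite U" "card U \<le> 2 * p" "V \<subseteq> U" "L \<subseteq> V" "p \<le> card L"
  shows "log 2 (real p) \<le> real (field_bits V) \<and> real (field_bits V) \<le> log 2 (real p) + 2"
proof -
  have "card L \<le> card V" "card V \<le> card U"
    using assms by (meson card_mono finite_subset)+
  then show ?thesis
    using field_bits_bounds[of p V] assms by linarith
qed

text \<open>The constant 8 allows 2 bits of slack for each of the four scalar fields.\<close>

lemma memory_bits_bounds:
  assumes "0 < k" "0 < W" "k dvd W"
  shows "\<bar>real (memory_bits W k) - (real k + 2 * log 2 (real W))\<bar> \<le> 8"
proof -
  define n where "n = W div k"
  define R where "R = reachable_states W k"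
  have n: "0 < n" using assms by (auto simp: n_def elim: dvdE)
  have W: "W = n * k" using assms by (simp add: n_def)
  have inv: "counter_invariant n k s" if "s \<in> R" for s
    using counter_invariant_reachable[of k W s] that assms n by (simp add: n_def R_def)
  define S where "S t = foldl (add_bit W k) (initial_state k) (replicate t True)" for t
  have S: "S t \<in> R" for t
    using run_ones_reachable by (simp add: S_def R_def)
  note run = run_ones[of W k, folded n_def, OF n, folded S_def]
  have small: "reg_y (S t) = int t" "reg_m (S t) = t" if "t < n" for t
  proof -
    have "t \<le> k * n" using that assms by (cases k) auto
    then show "reg_y (S t) = int t" "reg_m (S t) = t" using that by (simp_all add: run)
  qed
  \<comment> \<open>Block boundaries suffice for \<open>i\<close> and \<open>B\<close>, which change
    only there.\<close>
  have large: "reg_i (S (j * n)) = j" "reg_B (S (j * n)) = int j" if "j < k" for j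
    using that n by (simp_all add: run)
  have y: "log 2 (real n) \<le> field_bits (reg_y ` R) \<and> field_bits (reg_y ` R) \<le> log 2 (real n) + 2"
  proof (rule field_bits_between[where U = "{0..<2 * int n}" and L = "int ` {..<n}"])
    show "reg_y ` R \<subseteq> {0..<2 * int n}"
      using inv by (fastforce simp: counter_invariant_def)
    show "int ` {..<n} \<subseteq> reg_y ` R"
      using small S by (metis imageI image_subsetI lessThan_iff)
  qed (use n in \<open>simp_all add: card_image\<close>)
  have m: "log 2 (real n) \<le> field_bits (reg_m ` R) \<and> field_bits (reg_m ` R) \<le> log 2 (real n) + 2"
  proof (rule field_bits_between[where U = "{..<n}" and L = "{..<n}"])
    show "reg_m ` R \<subseteq> {..<n}"
      using inv by (auto simp: counter_invariant_def)
    show "{..<n} \<subseteq> reg_m ` R"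
      using small S by (metis imageI lessThan_iff subsetI)
  qed (use n in simp_all)
  have i: "log 2 (real k) \<le> field_bits (reg_i ` R) \<and> field_bits (reg_i ` R) \<le> log 2 (real k) + 2"
  proof (rule field_bits_between[where U = "{..<k}" and L = "{..<k}"])
    show "reg_i ` R \<subseteq> {..<k}"
      using inv by (auto simp: counter_invariant_def)
    show "{..<k} \<subseteq> reg_i ` R"
      using large S by (metis imageI lessThan_iff subsetI)
  qed (use assms in simp_all)
  have B: "log 2 (real k) \<le> field_bits (reg_B ` R) \<and> field_bits (reg_B ` R) \<le> log 2 (real k) + 2"
  proof (rule field_bits_between[where U = "{0..int k}" and L = "int ` {..<k}"])
    have "reg_B s \<in> {0..int k}" if "s \<in> R" for s
    proof -
      have "(\<Sum>j<k. of_bool (arr_b s ! j) :: int) \<le> (\<Sum>j<k. 1)"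
        by (rule sum_mono) simp
      moreover have "0 \<le> (\<Sum>j<k. of_bool (arr_b s ! j) :: int)"
        by (rule sum_nonneg) simp
      ultimately show ?thesis
        using inv[OF that] unfolding counter_invariant_def by simp
    qed
    then show "reg_B ` R \<subseteq> {0..int k}" by blast
    show "int ` {..<k} \<subseteq> reg_B ` R"
      using large S by (metis imageI image_subsetI lessThan_iff)
  qed (use assms in \<open>simp_all add: card_image\<close>)
  have "log 2 (real W) = log 2 (real n) + log 2 (real k)"
    using n assms(1) by (simp add: W log_mult)
  moreover have "real (memory_bits W k) = real (field_bits (reg_y ` R)) + real (field_bits (reg_m ` R))
      + real (field_bits (reg_i ` R)) + real (field_bits (reg_B ` R)) + real k"
    by (simp add: memory_bits_def Let_def R_def)
  ultimately show ?thesis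
    using y m i B by linarith
qed

text \<open>The first two terms are the errors for \<open>x <= sqrt W\<close> and
  \<open>x > sqrt W\<close>, added so that one bound covers both cases; the third absorbs the
  bounded remainder. No term involves \<epsilon>, which gives uniformity.\<close>

definition ratio_excess :: "real \<Rightarrow> nat \<Rightarrow> real" where
  "ratio_excess C W = 1 / sqrt (real W) + 4 * log 2 (real W) / sqrt (real W) + \<bar>C\<bar> / log 2 (real W)"

lemma ratio_excess_tendsto_0: "ratio_excess C \<longlonglongrightarrow> 0"
  unfolding ratio_excess_def by real_asymp

lemma admissible_ge_2:
  assumes "admissible W \<epsilon>"
  shows "2 \<le> W"
proof -
  have "1 / (2 * real W) \<le> 1 / 4" "0 < W"
    using assms unfolding admissible_def by linarith+
  then show ?thesis by (simp add: field_simps)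
qed

lemma ratio_le:
  assumes adm: "admissible W \<epsilon>" and r: "\<bar>r\<bar> \<le> C"
  shows "(1 / (2 * \<epsilon>) + 2 * log 2 (real W) + r) / counting_lower_bound W \<epsilon> \<le> 3 + ratio_excess C W"
proof -
  define x where "x = 1 / (2 * \<epsilon>)"
  define w where "w = real W"
  define l where "l = log 2 w"
  define M where "M = counting_lower_bound W \<epsilon>"
  have w: "2 \<le> w" using admissible_ge_2[OF adm] by (simp add: w_def)
  have eps: "1 / (2 * w) \<le> \<epsilon>" using adm by (simp add: admissible_def w_def)
  have "0 < 1 / (2 * w)" using w by simp
  then have eps0: "0 < \<epsilon>" using eps by linarith
  have x: "0 < x" "x \<le> w"
    using eps eps0 w by (simp_all add: x_def field_simps)
  have l: "1 \<le> l"
    using w by (simp add: l_def)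
  have Mmax: "M = max l (1 / (1 / x + 1 / w))"
    using eps0 by (simp add: M_def counting_lower_bound_def l_def w_def x_def)
  then have Ml: "l \<le> M" and Mx: "1 / (1 / x + 1 / w) \<le> M" by simp_all
  then have M: "0 < M" using l by linarith
  have "x * w / (x + w) \<le> M"
    using Mx x w by (simp add: field_simps)
  then have "x * w \<le> M * (x + w)"
    using x w by (simp add: pos_divide_le_eq)
  then have xM: "x / M \<le> 1 + x / w"
    using M w by (simp add: field_simps)
  have "r / M \<le> \<bar>C\<bar> / M"
    using r M by (simp add: divide_right_mono)
  \<comment> \<open>Replacing \<open>M\<close> by the smaller \<open>l\<close> requires a
    nonnegative numerator, hence the absolute value.\<close>
  also have "\<dots> \<le> \<bar>C\<bar> / l"
    using Ml l M by (intro divide_left_mono) auto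
  finally have rM: "r / M \<le> \<bar>C\<bar> / l" .
  have s: "0 < sqrt w" "sqrt w * sqrt w = w"
    using w by simp_all
  have main: "x / M + 2 * l / M \<le> 3 + 1 / sqrt w + 4 * l / sqrt w"
  proof (cases "x \<le> sqrt w")
    case True
    have "x / w \<le> sqrt w / w" using True w by (simp add: divide_right_mono)
    also have "\<dots> = 1 / sqrt w" using s by (metis div_by_1 divide_divide_eq_left mult_1 nonzero_divide_mult_cancel_left order_less_irrefl)
    finally have "x / w \<le> 1 / sqrt w" .
    moreover have "2 * l / M \<le> 2" using Ml M by (simp add: field_simps)
    moreover have "0 \<le> 4 * l / sqrt w" using l s by simp
    ultimately show ?thesis using xM by linarith
  next
    case False
    have "x / w \<le> 1" using x w by simp
    then have x2: "x / M \<le> 2" using xM by linarith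
    \<comment> \<open>Here \<open>sqrt w < x <= 2 * M\<close>.\<close>
    then have "sqrt w / 2 \<le> M" using False M by (simp add: field_simps)
    then have "2 * l / M \<le> 2 * l / (sqrt w / 2)"
      using l M s by (intro divide_left_mono mult_pos_pos) linarith+
    then have "2 * l / M \<le> 4 * l / sqrt w" by simp
    moreover have "0 \<le> 1 / sqrt w" using s by simp
    ultimately show ?thesis using x2 by linarith
  qed
  have "(x + 2 * l + r) / M \<le> 3 + (1 / sqrt w + 4 * l / sqrt w + \<bar>C\<bar> / l)"
    using main rM by (simp add: add_divide_distrib)
  then show ?thesis
    by (simp add: x_def l_def w_def M_def ratio_excess_def)
qed

lemma memory_bits_admissible:
  assumes "admissible W \<epsilon>" "block_count W \<epsilon> k"
  shows "\<bar>real (memory_bits W k) - (1 / (2 * \<epsilon>) + 2 * log 2 (real W))\<bar> \<le> 8"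
proof -
  have "0 < W" "k dvd W" "real k = 1 / (2 * \<epsilon>)"
    using assms by (auto simp: admissible_def block_count_def)
  then show ?thesis
    \<comment> \<open>Positivity of \<open>k\<close> follows from \<open>k dvd W\<close> and
      \<open>W > 0\<close>.\<close>
    using memory_bits_bounds[of k W] by (auto simp: dvd_def)
qed

text \<open>Choosing \<delta> before \<epsilon> expresses that the o(1) is uniform. The last
  conjunct reads O(1) as an arbitrary remainder bounded by \<open>C\<close>, so there \<delta> may
  depend on \<open>C\<close>.\<close>

theorem corollary9:
  shows "(\<exists>C::real. \<forall>W \<epsilon> k. admissible W \<epsilon> \<longrightarrow> block_count W \<epsilon> k \<longrightarrow>
            \<bar>real (memory_bits W k) - (1 / (2 * \<epsilon>) + 2 * log 2 (real W))\<bar> \<le> C)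
       \<and> (\<exists>\<delta>::nat \<Rightarrow> real. \<delta> \<longlonglongrightarrow> 0 \<and>
            (\<forall>W \<epsilon> k. admissible W \<epsilon> \<longrightarrow> block_count W \<epsilon> k \<longrightarrow>
              real (memory_bits W k) / counting_lower_bound W \<epsilon> \<le> 3 + \<delta> W))
       \<and> (\<forall>C::real. \<exists>\<delta>::nat \<Rightarrow> real. \<delta> \<longlonglongrightarrow> 0 \<and>
            (\<forall>W \<epsilon> r. admissible W \<epsilon> \<longrightarrow> \<bar>r\<bar> \<le> C \<longrightarrow>
              (1 / (2 * \<epsilon>) + 2 * log 2 (real W) + r) / counting_lower_bound W \<epsilon> \<le> 3 + \<delta> W))"
proof (intro conjI allI)
  show "\<exists>C::real. \<forall>W \<epsilon> k. admissible W \<epsilon> \<longrightarrow> block_count W \<epsilon> k \<longrightarrow>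
      \<bar>real (memory_bits W k) - (1 / (2 * \<epsilon>) + 2 * log 2 (real W))\<bar> \<le> C"
    using memory_bits_admissible by blast
  \<comment> \<open>The remainder \<open>r\<close> is the deviation of the actual memory from its
    leading terms, at most 8.\<close>
  have "real (memory_bits W k) / counting_lower_bound W \<epsilon> \<le> 3 + ratio_excess 8 W"
    if "admissible W \<epsilon>" "block_count W \<epsilon> k" for W \<epsilon> k
    using ratio_le[OF that(1) memory_bits_admissible[OF that]] by simp
  then show "\<exists>\<delta>::nat \<Rightarrow> real. \<delta> \<longlonglongrightarrow> 0 \<and>
      (\<forall>W \<epsilon> k. admissible W \<epsilon> \<longrightarrow> block_count W \<epsilon> k \<longrightarrow>
        real (memory_bits W k) / counting_lower_bound W \<epsilon> \<le> 3 + \<delta> W)"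
    using ratio_excess_tendsto_0 by blast
  show "\<exists>\<delta>::nat \<Rightarrow> real. \<delta> \<longlonglongrightarrow> 0 \<and>
      (\<forall>W \<epsilon> r. admissible W \<epsilon> \<longrightarrow> \<bar>r\<bar> \<le> C \<longrightarrow>
        (1 / (2 * \<epsilon>) + 2 * log 2 (real W) + r) / counting_lower_bound W \<epsilon> \<le> 3 + \<delta> W)" for C :: real
    using ratio_excess_tendsto_0 ratio_le by blast
qed

end
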